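(* Let $A^{\tau}(t,z)=\sum_{n,k\ge0}a^{\tau}_{n,k}t^nz^k$, where $a^{\tau}_{n,k}$ is the number of permutations in $S_n$ avoiding the classical pattern $3\textrm{-}1\textrm{-}2$ and containing exactly $k$ occurrences of the consecutive pattern $\tau$. Then $A^{132}(t,z)=A^{231}(t,z)$.
   Context: A permutation $\sigma\in S_n$ avoids the classical pattern $3\textrm{-}1\textrm{-}2$ if there are no indices $i<j<l$ with $\sigma(j)<\sigma(l)<\sigma(i)$. An occurrence of the consecutive pattern $132$ (resp. $231$) in $\sigma$ is an index $i$ with $\sigma(i)<\sigma(i+2)<\sigma(i+1)$ (resp. $\sigma(i+2)<\sigma(i)<\sigma(i+1)$). *)

theory Defs
  imports "HOL-Combinatorics.Permutations" "HOL-Computational_Algebra.Formal_Power_Series"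
begin

definition avoids_3_1_2 :: "nat \<Rightarrow> (nat \<Rightarrow> nat) \<Rightarrow> bool" where
  "avoids_3_1_2 n \<sigma> \<longleftrightarrow>
     \<not> (\<exists>i j l. 1 \<le> i \<and> i < j \<and> j < l \<and> l \<le> n \<and> \<sigma> j < \<sigma> l \<and> \<sigma> l < \<sigma> i)"

text \<open>A consecutive pattern of length three is given by the order condition it imposes on
  three consecutive values.\<close>

definition pat132 :: "nat \<Rightarrow> nat \<Rightarrow> nat \<Rightarrow> bool" where
  "pat132 x y z \<longleftrightarrow> x < z \<and> z < y"

definition pat231 :: "nat \<Rightarrow> nat \<Rightarrow> nat \<Rightarrow> bool" where
  "pat231 x y z \<longleftrightarrow> z < x \<and> x < y"

definition occurrences ::
    "(nat \<Rightarrow> nat \<Rightarrow> nat \<Rightarrow> bool) \<Rightarrow> nat \<Rightarrow> (nat \<Rightarrow> nat) \<Rightarrow> nat set" where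
  "occurrences \<tau> n \<sigma> = {i. 1 \<le> i \<and> i + 2 \<le> n \<and> \<tau> (\<sigma> i) (\<sigma> (i + 1)) (\<sigma> (i + 2))}"

definition num_avoiding :: "(nat \<Rightarrow> nat \<Rightarrow> nat \<Rightarrow> bool) \<Rightarrow> nat \<Rightarrow> nat \<Rightarrow> nat" where
  "num_avoiding \<tau> n k =
     card {\<sigma>. \<sigma> permutes {1..n} \<and> avoids_3_1_2 n \<sigma> \<and> card (occurrences \<tau> n \<sigma>) = k}"

text \<open>Bivariate formal power series: the outer variable is \<open>t\<close> (marking the size \<open>n\<close>), the inner
  one is \<open>z\<close> (marking the number \<open>k\<close> of occurrences).\<close>

definition gen_fun :: "(nat \<Rightarrow> nat \<Rightarrow> nat \<Rightarrow> bool) \<Rightarrow> int fps fps" where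
  "gen_fun \<tau> = Abs_fps (\<lambda>n. Abs_fps (\<lambda>k. int (num_avoiding \<tau> n k)))"

end

theory Submission
  imports Defs "HOL-Library.Tree"
begin

text \<open>
  If a permutation avoiding 3-1-2 is written as \<open>L 1 R\<close>, then every entry of \<open>L\<close> is smaller than
  every entry of \<open>R\<close>, so iterating this decomposition encodes the permutation by a binary tree.
  Besides the occurrences inside \<open>L\<close> and \<open>R\<close>, there is one further occurrence of 132 iff \<open>R\<close> starts
  with a descent, and one further occurrence of 231 iff \<open>L\<close> ends with an ascent. Now \<open>L 1 R\<close> starts
  with a descent iff \<open>L\<close> has one entry or starts with a descent, and it ends with an ascent iff
  \<open>R\<close> has one entry or ends with an ascent. Hence mirroring the tree exchanges the two statistics.
\<close>

section \<open>Patterns in lists\<close>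

text \<open>The head \<open>x\<close> plays the 3. The relation given to \<open>sorted_wrt\<close>
  is no ordering; it is only tested on all pairs of later positions, as candidates for the 1 and the
  2.\<close>

fun avoids312 :: "nat list \<Rightarrow> bool" where
  "avoids312 [] \<longleftrightarrow> True"
| "avoids312 (x # xs) \<longleftrightarrow> sorted_wrt (\<lambda>y z. \<not> (y < z \<and> z < x)) xs \<and> avoids312 xs"

fun occ :: "(nat \<Rightarrow> nat \<Rightarrow> nat \<Rightarrow> bool) \<Rightarrow> nat list \<Rightarrow> nat" where
  "occ \<tau> (x # y # z # xs) = of_bool (\<tau> x y z) + occ \<tau> (y # z # xs)"
| "occ \<tau> _ = 0"

fun starts_desc :: "nat list \<Rightarrow> bool" where
  "starts_desc (x # y # xs) \<longleftrightarrow> y < x"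
| "starts_desc _ \<longleftrightarrow> False"

fun ends_asc :: "nat list \<Rightarrow> bool" where
  "ends_asc [x, y] \<longleftrightarrow> x < y"
| "ends_asc (x # y # z # xs) \<longleftrightarrow> ends_asc (y # z # xs)"
| "ends_asc _ \<longleftrightarrow> False"

section \<open>Splitting a list at its minimum\<close>

text \<open>An entry of \<open>ys\<close> below some \<open>x\<close> in \<open>xs\<close> would
  complete a 3-1-2 with \<open>x\<close> and the \<open>a\<close> between them. Conversely, if
  \<open>xs\<close> lies below \<open>ys\<close>, no occurrence has its 3 in \<open>xs\<close> and
  its 2 in \<open>ys\<close>, which leaves no role for \<open>a\<close> either.\<close>

lemma avoids312_append_min:
  assumes "\<forall>x \<in> set xs \<union> set ys. a < x" and "set xs \<inter> set ys = {}"
  shows "avoids312 (xs @ a # ys) \<longleftrightarrow>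
    avoids312 xs \<and> avoids312 ys \<and> (\<forall>x\<in>set xs. \<forall>y\<in>set ys. x < y)"
  using assms
proof (induction xs)
  case Nil
  then show ?case
    by (auto intro!: sorted_wrt_mono_rel[OF _ sorted_wrt_true])
next
  case (Cons x xs)
  have "sorted_wrt (\<lambda>y z. \<not> (y < z \<and> z < x)) (xs @ a # ys) \<longleftrightarrow>
    sorted_wrt (\<lambda>y z. \<not> (y < z \<and> z < x)) xs \<and> (\<forall>y\<in>set ys. x < y)"
    (is "?l \<longleftrightarrow> ?r")
  proof
    assume ?l
    \<comment> \<open>The pair \<open>a\<close>, \<open>y\<close> only rules out
      \<open>y < x\<close>; distinctness makes this strict.\<close>
    moreover have "x \<noteq> y" if "y \<in> set ys" for y
      using that Cons.prems by auto
    ultimately show ?r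
      using Cons.prems by (force simp: sorted_wrt_append)
  next
    assume r: ?r
    have "sorted_wrt (\<lambda>y z. \<not> (y < z \<and> z < x)) ys"
      using r by (auto intro!: sorted_wrt_mono_rel[OF _ sorted_wrt_true])
    moreover have "a < y" if "y \<in> set xs" for y
      using that Cons.prems(1) by simp
    ultimately show ?l
      using r by (auto simp: sorted_wrt_append dest: less_asym)
  qed
  then show ?case
    using Cons by auto
qed

lemma avoids312_iff_nth:
  "avoids312 xs \<longleftrightarrow>
    \<not> (\<exists>i j l. i < j \<and> j < l \<and> l < length xs \<and> xs ! j < xs ! l \<and> xs ! l < xs ! i)"
proof (induction xs)
  case Nil
  then show ?case by simp
next
  case (Cons x xs)
  have "(\<exists>i j l. i < j \<and> j < l \<and> l < length (x # xs) \<and> (x # xs) ! j < (x # xs) ! l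
        \<and> (x # xs) ! l < (x # xs) ! i) \<longleftrightarrow>
      (\<exists>j l. j < l \<and> l < length xs \<and> xs ! j < xs ! l \<and> xs ! l < x) \<or>
      (\<exists>i j l. i < j \<and> j < l \<and> l < length xs \<and> xs ! j < xs ! l \<and> xs ! l < xs ! i)"
    (is "?l \<longleftrightarrow> ?r1 \<or> ?r2")
  proof
    assume ?l
    then obtain i j l where h: "i < j" "j < l" "l < length (x # xs)" "(x # xs) ! j < (x # xs) ! l"
        "(x # xs) ! l < (x # xs) ! i"
      by blast
    then obtain j' l' where "j = Suc j'" "l = Suc l'"
      by (metis less_nat_zero_code not0_implies_Suc)
    with h show "?r1 \<or> ?r2"
      by (cases i) auto
  next
    assume "?r1 \<or> ?r2"
    then show ?l
    proof
      assume ?r1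
      then obtain j l where "j < l" "l < length xs" "xs ! j < xs ! l" "xs ! l < x"
        by blast
      then show ?l
        by (intro exI[of _ 0] exI[of _ "Suc j"] exI[of _ "Suc l"]) auto
    next
      assume ?r2
      then obtain i j l where "i < j" "j < l" "l < length xs" "xs ! j < xs ! l" "xs ! l < xs ! i"
        by blast
      then show ?l
        by (intro exI[of _ "Suc i"] exI[of _ "Suc j"] exI[of _ "Suc l"]) auto
    qed
  qed
  then show ?case
    by (simp only: avoids312.simps Cons.IH sorted_wrt_iff_nth_less) blast
qed

text \<open>Being the smallest entry of every window through it, \<open>a\<close> can only come
  first in a 132, and that window continues with the first two entries of \<open>ys\<close>.\<close>

lemma occ_132_append_min:
  assumes "\<forall>x \<in> set xs \<union> set ys. a < x"
  shows "occ pat132 (xs @ a # ys) = occ pat132 xs + occ pat132 ys + of_bool (starts_desc ys)"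
  using assms
\<comment> \<open>If \<open>xs\<close> has three or more entries, its first window is unaffected by
  \<open>a # ys\<close>. The windows through \<open>a\<close> are settled in the base cases, where
  the length of \<open>ys\<close> matters.\<close>
proof (induction pat132 xs rule: occ.induct)
  case ("2_1")
  then show ?case
    by (cases ys rule: starts_desc.cases) (auto simp: pat132_def)
next
  case ("2_2" x)
  then show ?case
    by (cases ys rule: starts_desc.cases) (auto simp: pat132_def)
next
  case ("2_3" x y)
  then show ?case
    by (cases ys rule: starts_desc.cases) (auto simp: pat132_def)
qed auto

text \<open>In a 231 the smallest entry comes last, so the only new window is formed by the last two
  entries of \<open>xs\<close> and \<open>a\<close>.\<close>

lemma occ_231_append_min:
  assumes "\<forall>x \<in> set xs \<union> set ys. a < x"
  shows "occ pat231 (xs @ a # ys) = occ pat231 xs + occ pat231 ys + of_bool (ends_asc xs)"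
  using assms
proof (induction pat231 xs rule: occ.induct)
  case ("2_1")
  then show ?case
    by (cases ys rule: starts_desc.cases) (auto simp: pat231_def)
next
  case ("2_2" x)
  then show ?case
    by (cases ys rule: starts_desc.cases) (auto simp: pat231_def)
next
  case ("2_3" x y)
  then show ?case
    by (cases ys rule: starts_desc.cases) (auto simp: pat231_def)
qed auto

text \<open>A single entry in \<open>xs\<close> is followed by the smaller \<open>a\<close>, whereas
  for empty \<open>xs\<close> the list starts with its minimum and cannot start with a
  descent.\<close>

lemma starts_desc_append_min:
  assumes "\<forall>x \<in> set xs \<union> set ys. a < x"
  shows "starts_desc (xs @ a # ys) \<longleftrightarrow> length xs = 1 \<or> starts_desc xs"
  using assms
  by (cases xs rule: starts_desc.cases; cases ys) auto

lemma ends_asc_append_min: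
  assumes "\<forall>x \<in> set xs \<union> set ys. a < x"
  shows "ends_asc (xs @ a # ys) \<longleftrightarrow> length ys = 1 \<or> ends_asc ys"
  using assms
proof (induction xs rule: ends_asc.induct)
  case ("3_1")
  then show ?case by (cases ys rule: starts_desc.cases) auto
next
  case ("3_2" x)
  then show ?case by (cases ys rule: starts_desc.cases) auto
next
  case (1 x y)
  then show ?case by (cases ys rule: starts_desc.cases) auto
qed auto

section \<open>Encoding by binary trees\<close>

text \<open>The nodes are numbered in preorder from \<open>a\<close> on and read in inorder. The
  shape determines all labels, hence \<open>unit tree\<close>.\<close>

fun word :: "nat \<Rightarrow> unit tree \<Rightarrow> nat list" where
  "word a Leaf = []"
| "word a (Node l _ r) = word (Suc a) l @ a # word (Suc a + size l) r"

lemma length_word [simp]: "length (word a t) = size t"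
  by (induction a t rule: word.induct) auto

lemma set_word [simp]: "set (word a t) = {a..<a + size t}"
  by (induction a t rule: word.induct) auto

lemma distinct_word: "distinct (word a t)"
  by (induction a t rule: word.induct) auto

lemma avoids312_word: "avoids312 (word a t)"
proof (induction a t rule: word.induct)
  case (2 a l u r)
  then show ?case
    unfolding word.simps by (subst avoids312_append_min) auto
qed simp

text \<open>The label \<open>a\<close> occurs only at the root, so the word determines where to cut
  it into the words of the two subtrees.\<close>

lemma word_eq_iff: "word a s = word a t \<longleftrightarrow> s = t"
proof
  show "word a s = word a t \<Longrightarrow> s = t"
  proof (induction a s arbitrary: t rule: word.induct)
    case (1 a)
    then show ?case
      by (cases t) auto
  next
    case (2 a l u r)
    from "2.prems" obtain l' u' r' where t: "t = Node l' u' r'"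
      by (cases t) auto
    have "word (Suc a) l = word (Suc a) l' \<and> word (Suc a + size l) r = word (Suc a + size l') r'"
      using "2.prems" append_Cons_eq_iff[of a "word (Suc a) l" "word (Suc a + size l) r"
          "word (Suc a) l'" "word (Suc a + size l') r'"]
      by (simp add: t)
    \<comment> \<open>Equal sizes give both right subtrees the same offset, as the induction
      hypothesis requires.\<close>
    moreover from this have "size l = size l'"
      by (metis length_word)
    ultimately show ?case
      using "2.IH" by (simp add: t)
  qed
qed simp

lemma interval_split:
  fixes A B :: "nat set"
  assumes "A \<union> B = {a..<b}" and less: "\<forall>x\<in>A. \<forall>y\<in>B. x < y"
  shows "A = {a..<a + card A} \<and> B = {a + card A..<b}"
proof (cases "B = {}")
  case True
  then show ?thesis
    using assms by (cases "a \<le> b") auto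
next
  case False
  have fin: "finite B"
    by (metis assms(1) finite_Un finite_atLeastLessThan)
  \<comment> \<open>The minimum of \<open>B\<close> is the cut point of the interval.\<close>
  define m where "m = Min B"
  have m: "m \<in> B" "\<And>y. y \<in> B \<Longrightarrow> m \<le> y"
    using False fin by (auto simp: m_def)
  have iff: "x \<in> A \<or> x \<in> B \<longleftrightarrow> a \<le> x \<and> x < b" for x
    using assms(1) by (metis UnI1 UnI2 UnE atLeastLessThan_iff)
  have A: "x \<in> A \<longleftrightarrow> a \<le> x \<and> x < m" for x
    using m less iff[of x] iff[of m] by (metis leD less_trans)
  have B: "x \<in> B \<longleftrightarrow> m \<le> x \<and> x < b" for x
    using m less iff[of x] iff[of m] by (metis leD le_trans)
  have "A = {a..<m}" "B = {m..<b}"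
    by (simp_all add: set_eq_iff A B)
  moreover have "a \<le> m"
    using m(1) iff[of m] by blast
  ultimately show ?thesis
    by simp
qed

text \<open>The tree is rebuilt by cutting at the minimum \<open>a\<close>; both sides are shorter
  and again fill intervals of labels.\<close>

lemma ex_word:
  assumes "distinct xs" and "set xs = {a..<a + length xs}" and "avoids312 xs"
  shows "\<exists>t. word a t = xs"
  using assms
proof (induction xs arbitrary: a rule: length_induct)
  case (1 xs)
  show ?case
  proof (cases "xs = []")
    case True
    then show ?thesis
      by (intro exI[of _ Leaf]) simp
  next
    case False
    then have "a \<in> set xs"
      using "1.prems"(2) by simp
    then obtain ls rs where xs: "xs = ls @ a # rs"
      by (meson split_list)
    have un: "set ls \<union> set rs = {Suc a..<a + length xs}"
    proof -
      have "set ls \<union> set rs = set xs - {a}"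
        using "1.prems"(1) xs by auto
      also have "\<dots> = {Suc a..<a + length xs}"
        unfolding "1.prems"(2) by auto
      finally show ?thesis .
    qed
    then have "\<forall>x \<in> set ls \<union> set rs. a < x"
      by auto
    moreover have "set ls \<inter> set rs = {}"
      using "1.prems"(1) xs by auto
    ultimately have av: "avoids312 ls" "avoids312 rs" "\<forall>x\<in>set ls. \<forall>y\<in>set rs. x < y"
      using "1.prems"(3) avoids312_append_min[of ls rs a] unfolding xs by auto
    have dist: "distinct ls" "distinct rs"
      using "1.prems"(1) xs by auto
    \<comment> \<open>These are exactly the label ranges that \<open>word\<close> gives to the left
      and right subtree.\<close>
    have sets: "set ls = {Suc a..<Suc a + length ls}"
      "set rs = {Suc a + length ls..<Suc a + length ls + length rs}"
      using interval_split[OF un av(3)] dist xs by (auto simp: distinct_card)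
    obtain l where l: "word (Suc a) l = ls"
      using "1.IH" sets(1) av(1) dist(1) xs by force
    obtain r where r: "word (Suc a + length ls) r = rs"
      using "1.IH" sets(2) av(2) dist(2) xs by force
    have "size l = length ls"
      using l length_word by metis
    then have "word a (Node l () r) = xs"
      using l r xs by simp
    then show ?thesis ..
  qed
qed

lemma word_image:
  "word a ` {t. size t = n} = {xs. distinct xs \<and> set xs = {a..<a + n} \<and> avoids312 xs}"
proof (intro equalityI subsetI)
  fix xs assume "xs \<in> {xs. distinct xs \<and> set xs = {a..<a + n} \<and> avoids312 xs}"
  then have xs: "distinct xs" "set xs = {a..<a + n}" "avoids312 xs"
    by auto
  then have len: "length xs = n"
    using distinct_card[of xs] by simp
  then obtain t where "word a t = xs"
    using ex_word xs by blast
  moreover from this have "size t = n"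
    using len length_word by metis
  ultimately show "xs \<in> word a ` {t. size t = n}"
    by blast
qed (auto simp: distinct_word avoids312_word)

section \<open>Mirroring exchanges the statistics\<close>

text \<open>The offsets \<open>a\<close> and \<open>b\<close> are independent because mirroring
  changes the labels at which the subtrees start.\<close>

lemma starts_desc_word_iff_ends_asc_mirror:
  "starts_desc (word a t) \<longleftrightarrow> ends_asc (word b (mirror t))"
proof (induction t arbitrary: a b)
  case (Node l u r)
  have "starts_desc (word a (Node l u r)) \<longleftrightarrow> size l = 1 \<or> starts_desc (word (Suc a) l)"
    unfolding word.simps by (subst starts_desc_append_min) auto
  also have "\<dots> \<longleftrightarrow> size l = 1 \<or> ends_asc (word (Suc b + size r) (mirror l))"
    using Node.IH(1) by blast
  also have "\<dots> \<longleftrightarrow> ends_asc (word b (mirror (Node l u r)))"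
    unfolding mirror.simps word.simps by (subst ends_asc_append_min) auto
  finally show ?case .
qed simp

lemma occ_132_word_eq_occ_231_mirror:
  "occ pat132 (word a t) = occ pat231 (word b (mirror t))"
proof (induction t arbitrary: a b)
  case (Node l u r)
  have "occ pat132 (word a (Node l u r)) = occ pat132 (word (Suc a) l)
      + occ pat132 (word (Suc a + size l) r) + of_bool (starts_desc (word (Suc a + size l) r))"
    unfolding word.simps by (subst occ_132_append_min) auto
  \<comment> \<open>After mirroring, \<open>r\<close> comes first and takes the labels from
    \<open>Suc b\<close> on, so \<open>l\<close> starts \<open>size r\<close> later.\<close>
  also have "\<dots> = occ pat231 (word (Suc b + size r) (mirror l))
      + occ pat231 (word (Suc b) (mirror r)) + of_bool (ends_asc (word (Suc b) (mirror r)))"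
    by (simp only: Node.IH(1)[of "Suc a" "Suc b + size r"]
        Node.IH(2)[of "Suc a + size l" "Suc b"]
        starts_desc_word_iff_ends_asc_mirror[of "Suc a + size l" r "Suc b"])
  also have "\<dots> = occ pat231 (word b (mirror (Node l u r)))"
    unfolding mirror.simps word.simps by (subst occ_231_append_min) auto
  finally show ?case .
qed simp

section \<open>From permutations to lists\<close>

lemma occ_eq_card_nth:
  "occ \<tau> xs = card {i. i + 2 < length xs \<and> \<tau> (xs ! i) (xs ! (i + 1)) (xs ! (i + 2))}"
proof (induction \<tau> xs rule: occ.induct)
  case (1 \<tau> x y z xs)
  let ?S = "\<lambda>xs. {i. i + 2 < length xs \<and> \<tau> (xs ! i) (xs ! (i + 1)) (xs ! (i + 2))}"
  have fin: "finite (?S ys)" for ys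
    by (rule finite_subset[of _ "{..<length ys}"]) auto
  \<comment> \<open>The window at position 0 is split off; all others are windows of the tail,
    shifted by one.\<close>
  have "?S (x # y # z # xs) = {i. i = 0 \<and> \<tau> x y z} \<union> Suc ` ?S (y # z # xs)"
    (is "?L = ?R")
  proof (intro set_eqI)
    fix i show "i \<in> ?L \<longleftrightarrow> i \<in> ?R"
      by (cases i) (auto simp: image_iff)
  qed
  moreover have "card (\<dots>) = card {i::nat. i = 0 \<and> \<tau> x y z} + card (Suc ` ?S (y # z # xs))"
    using fin by (intro card_Un_disjoint) auto
  moreover have "card {i::nat. i = 0 \<and> \<tau> x y z} = of_bool (\<tau> x y z)"
    by (cases "\<tau> x y z") auto
  ultimately show ?case
    using 1 by (simp add: card_image)
qed auto

definition one_line :: "nat \<Rightarrow> (nat \<Rightarrow> nat) \<Rightarrow> nat list" where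
  "one_line n \<sigma> = map \<sigma> [1..<Suc n]"

lemma length_one_line [simp]: "length (one_line n \<sigma>) = n"
  by (simp add: one_line_def)

lemma nth_one_line [simp]: "i < n \<Longrightarrow> one_line n \<sigma> ! i = \<sigma> (Suc i)"
  by (simp add: one_line_def del: upt_Suc)

lemma avoids312_one_line: "avoids312 (one_line n \<sigma>) \<longleftrightarrow> avoids_3_1_2 n \<sigma>"
proof -
  have "(\<exists>i j l. i < j \<and> j < l \<and> l < n \<and> one_line n \<sigma> ! j < one_line n \<sigma> ! l
        \<and> one_line n \<sigma> ! l < one_line n \<sigma> ! i) \<longleftrightarrow>
      (\<exists>i j l. 1 \<le> i \<and> i < j \<and> j < l \<and> l \<le> n \<and> \<sigma> j < \<sigma> l \<and> \<sigma> l < \<sigma> i)" (is "?l \<longleftrightarrow> ?r")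
  proof
    assume ?l
    then obtain i j l where h: "i < j" "j < l" "l < n" "one_line n \<sigma> ! j < one_line n \<sigma> ! l"
        "one_line n \<sigma> ! l < one_line n \<sigma> ! i"
      by blast
    then show ?r
      by (intro exI[of _ "Suc i"] exI[of _ "Suc j"] exI[of _ "Suc l"]) auto
  next
    assume ?r
    then obtain i j l where h: "1 \<le> i" "i < j" "j < l" "l \<le> n" "\<sigma> j < \<sigma> l" "\<sigma> l < \<sigma> i"
      by blast
    then show ?l
      by (intro exI[of _ "i - 1"] exI[of _ "j - 1"] exI[of _ "l - 1"]) auto
  qed
  then show ?thesis
    by (simp add: avoids312_iff_nth avoids_3_1_2_def)
qed

lemma occ_one_line: "occ \<tau> (one_line n \<sigma>) = card (occurrences \<tau> n \<sigma>)"
proof -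
  have "occurrences \<tau> n \<sigma> = Suc ` {i. i + 2 < n \<and>
      \<tau> (one_line n \<sigma> ! i) (one_line n \<sigma> ! (i + 1)) (one_line n \<sigma> ! (i + 2))}"
    (is "_ = ?R")
  proof (intro set_eqI)
    fix i show "i \<in> occurrences \<tau> n \<sigma> \<longleftrightarrow> i \<in> ?R"
      by (cases i) (auto simp: occurrences_def image_iff)
  qed
  then show ?thesis
    by (simp add: occ_eq_card_nth card_image)
qed

lemma bij_betw_one_line:
  "bij_betw (one_line n) {\<sigma>. \<sigma> permutes {1..n}} {xs. distinct xs \<and> set xs = {1..n}}"
proof (rule bij_betw_imageI)
  show "inj_on (one_line n) {\<sigma>. \<sigma> permutes {1..n}}"
  proof (intro inj_onI ext)
    fix \<sigma> \<rho> i
    assume *: "\<sigma> \<in> {\<sigma>. \<sigma> permutes {1..n}}" "\<rho> \<in> {\<sigma>. \<sigma> permutes {1..n}}"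
      "one_line n \<sigma> = one_line n \<rho>"
    show "\<sigma> i = \<rho> i"
    proof (cases "i \<in> {1..n}")
      case True
      then show ?thesis
        using *(3) by (auto simp: one_line_def)
    next
      case False
      then show ?thesis
        using *(1,2) by (simp add: permutes_not_in)
    qed
  qed
  show "one_line n ` {\<sigma>. \<sigma> permutes {1..n}} = {xs. distinct xs \<and> set xs = {1..n}}"
  proof (intro equalityI subsetI)
    fix xs assume "xs \<in> one_line n ` {\<sigma>. \<sigma> permutes {1..n}}"
    then obtain \<sigma> where \<sigma>: "\<sigma> permutes {1..n}" and xs: "xs = one_line n \<sigma>"
      by auto
    have "set [1..<Suc n] = {1..n}"
      by auto
    then show "xs \<in> {xs. distinct xs \<and> set xs = {1..n}}"
      using permutes_inj_on[OF \<sigma>] permutes_image[OF \<sigma>]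
      by (simp add: xs one_line_def distinct_map del: upt_Suc)
  next
    fix xs :: "nat list" assume "xs \<in> {xs. distinct xs \<and> set xs = {1..n}}"
    then have xs: "distinct xs" "set xs = {1..n}"
      by auto
    then have len: "length xs = n"
      using distinct_card[of xs] by simp
    \<comment> \<open>Lists are indexed from 0 and permutations from 1; \<open>permutes\<close>
      demands the identity outside \<open>{1..n}\<close>.\<close>
    define \<sigma> where "\<sigma> i = (if i \<in> {1..n} then xs ! (i - 1) else i)" for i
    have line: "one_line n \<sigma> = xs"
      by (rule nth_equalityI) (auto simp: len \<sigma>_def)
    have "set [1..<Suc n] = {1..n}"
      by auto
    then have "\<sigma> ` {1..n} = {1..n}" "inj_on \<sigma> {1..n}"
      using xs line by (auto simp: one_line_def distinct_map simp del: upt_Suc)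
    then have "\<sigma> permutes {1..n}"
      by (intro bij_imp_permutes bij_betw_imageI) (auto simp: \<sigma>_def)
    then show "xs \<in> one_line n ` {\<sigma>. \<sigma> permutes {1..n}}"
      using line by blast
  qed
qed

section \<open>Counting by trees\<close>

lemma num_avoiding_eq_card_trees:
  "num_avoiding \<tau> n k = card {t. size t = n \<and> occ \<tau> (word 1 t) = k}"
proof -
  let ?S = "{\<sigma>. \<sigma> permutes {1..n} \<and> avoids_3_1_2 n \<sigma> \<and> card (occurrences \<tau> n \<sigma>) = k}"
  let ?T = "{t. size t = n \<and> occ \<tau> (word 1 t) = k}"
  \<comment> \<open>The common image of \<open>?S\<close> under \<open>one_line n\<close> and of
    \<open>?T\<close> under \<open>word 1\<close>, both injective there.\<close>
  let ?W = "{xs. distinct xs \<and> set xs = {1..n} \<and> avoids312 xs \<and> occ \<tau> xs = k}"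
  have inj_line: "inj_on (one_line n) ?S"
    using bij_betw_one_line[of n] by (auto simp: bij_betw_def intro: inj_on_subset)
  have image_line: "one_line n ` ?S = ?W"
  proof -
    have "one_line n ` ?S = one_line n ` {\<sigma>. \<sigma> permutes {1..n}} \<inter> {xs. avoids312 xs \<and> occ \<tau> xs = k}"
      by (auto simp: avoids312_one_line occ_one_line)
    then show ?thesis
      using bij_betw_one_line[of n] by (auto simp: bij_betw_def)
  qed
  have inj_word: "inj_on (word 1) ?T"
    by (simp add: inj_on_def word_eq_iff del: One_nat_def)
  have image_word: "word 1 ` ?T = ?W"
  proof -
    have "word 1 ` ?T = word 1 ` {t. size t = n} \<inter> {xs. occ \<tau> xs = k}"
      by auto
    moreover have "{1..<1 + n} = {1..n}"
      by auto
    ultimately show ?thesis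
      by (auto simp: word_image simp del: One_nat_def)
  qed
  have "card ?S = card ?T"
    using card_image[OF inj_line] card_image[OF inj_word] unfolding image_line image_word by simp
  then show ?thesis
    by (simp add: num_avoiding_def)
qed

lemma num_avoiding_132_eq_231: "num_avoiding pat132 n k = num_avoiding pat231 n k"
proof -
  have "bij_betw mirror {t. size t = n \<and> occ pat132 (word 1 t) = k}
      {t. size t = n \<and> occ pat231 (word 1 t) = k}"
    \<comment> \<open>\<open>mirror\<close> is an involution preserving \<open>size\<close>; the
      free offset \<open>b\<close> is set to 1, where the labels start on both sides.\<close>
    by (rule bij_betw_byWitness[where f' = mirror])
      (auto simp: occ_132_word_eq_occ_231_mirror[where b = 1] simp del: One_nat_def)
  then show ?thesis
    by (simp only: num_avoiding_eq_card_trees bij_betw_same_card)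
qed

theorem theorem12: "gen_fun pat132 = gen_fun pat231"
  by (simp add: gen_fun_def num_avoiding_132_eq_231)

end
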